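(* Let $a,b$ be positive real numbers with $b>a$, let $0<\alpha\le 1$, and let $q\ge 1$. Then $$\left|12A(a^{\alpha+4},b^{\alpha+4}) - 12L_{\alpha+4}(a,b) - (b-a)^2(\alpha+3)(\alpha+4)L_{\alpha+2}(a,b)\right|$$ $$\le \frac{(b-a)^4}{60}(\alpha+1)(\alpha+2)(\alpha+3)(\alpha+4)\left(\max\{|a^{\alpha}|^q,|b^{\alpha}|^q\}\right)^{\frac1q}.$$
   Context: For positive numbers $x,y$, $A(x,y)=\frac{x+y}{2}$. For positive $a\ne b$ and real $r\ne -1,0$, $L_r(a,b)=\frac{b^{r+1}-a^{r+1}}{(r+1)(b-a)}$ (with no outer exponent $1/r$); only indices $r=\alpha+2$ and $r=\alpha+4$ are used. *)

theory Defs
  imports Complex_Main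
begin

definition A :: "real \<Rightarrow> real \<Rightarrow> real" where
  "A x y = (x + y) / 2"

text \<open>
  Generalized logarithmic mean without the outer exponent \<open>1/r\<close>; intended for
  positive \<open>a \<noteq> b\<close> and \<open>r \<noteq> -1, 0\<close>.
\<close>

definition L :: "real \<Rightarrow> real \<Rightarrow> real \<Rightarrow> real" where
  "L r a b = (b powr (r + 1) - a powr (r + 1)) / ((r + 1) * (b - a))"

end

theory Submission
  imports Defs
begin

text \<open>
  For \<open>f x = x powr (\<alpha> + 4)\<close> and \<open>h = b - a\<close>, the expression is \<open>12 / h\<close> times the error of the
  trapezoidal rule with endpoint correction \<open>h\<^sup>2 / 12 * (f' b - f' a)\<close>. Regarded as a function of
  the right endpoint \<open>x\<close>, this error (times \<open>12\<close>) vanishes at \<open>a\<close> together with its first two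
  derivatives, and its third derivative is \<open>- (x - a)\<^sup>2\<close> times the fourth derivative of \<open>f\<close>. Three
  integrations bound it by \<open>M * h ^ 5 / 60\<close>, where \<open>M\<close> bounds that fourth derivative.
\<close>

text \<open>Monotonicity takes the place of integration: a sign of the derivative passes to the
  function, and no integrals are needed. Each of the three integrations is one use of this.\<close>

lemma nonneg_if_deriv_nonneg:
  fixes g g' :: "real \<Rightarrow> real"
  assumes "\<And>x. a \<le> x \<Longrightarrow> x \<le> b \<Longrightarrow> (g has_real_derivative g' x) (at x)"
    and "\<And>x. a \<le> x \<Longrightarrow> x \<le> b \<Longrightarrow> 0 \<le> g' x"
    and "g a = 0" and "a \<le> x" "x \<le> b"
  shows "0 \<le> g x"
proof -
  have "g a \<le> g x"
  proof (rule DERIV_nonneg_imp_nondecreasing[where f = g])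
    fix y assume "a \<le> y" "y \<le> x"
    then have "a \<le> y" "y \<le> b" using assms by auto
    then show "\<exists>d. (g has_real_derivative d) (at y) \<and> 0 \<le> d"
      using assms(1,2) by blast
  qed fact
  then show ?thesis using assms by simp
qed

text \<open>With abstract \<open>F\<close>, ..., \<open>f4\<close>, differentiating the error takes
  only sum and product rules; powers enter in the application.\<close>

lemma corrected_trapezoid_error:
  fixes F f f1 f2 f3 f4 :: "real \<Rightarrow> real"
  assumes dF: "\<And>x. a \<le> x \<Longrightarrow> x \<le> b \<Longrightarrow> (F has_real_derivative f x) (at x)"
    and d0: "\<And>x. a \<le> x \<Longrightarrow> x \<le> b \<Longrightarrow> (f has_real_derivative f1 x) (at x)"
    and d1: "\<And>x. a \<le> x \<Longrightarrow> x \<le> b \<Longrightarrow> (f1 has_real_derivative f2 x) (at x)"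
    and d2: "\<And>x. a \<le> x \<Longrightarrow> x \<le> b \<Longrightarrow> (f2 has_real_derivative f3 x) (at x)"
    and d3: "\<And>x. a \<le> x \<Longrightarrow> x \<le> b \<Longrightarrow> (f3 has_real_derivative f4 x) (at x)"
    and bound: "\<And>x. a \<le> x \<Longrightarrow> x \<le> b \<Longrightarrow> \<bar>f4 x\<bar> \<le> M"
    and "a \<le> b"
  shows "\<bar>6 * (b - a) * (f a + f b) - 12 * (F b - F a) - (b - a)^2 * (f1 b - f1 a)\<bar>
           \<le> M * (b - a)^5 / 60"
proof -
  define G where "G x =
      6 * (x - a) * (f a + f x) - 12 * (F x - F a) - (x - a)^2 * (f1 x - f1 a)" for x
  define G1 where "G1 x =
      6 * (f a - f x) + 4 * (x - a) * f1 x + 2 * (x - a) * f1 a - (x - a)^2 * f2 x" for x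
  define G2 where "G2 x = 2 * (f1 a - f1 x) + 2 * (x - a) * f2 x - (x - a)^2 * f3 x" for x
  have D0: "(G has_real_derivative G1 x) (at x)" if "a \<le> x" "x \<le> b" for x
    unfolding G_def G1_def using that
    by (auto intro!: derivative_eq_intros dF d0 d1 simp: algebra_simps power2_eq_square)
  have D1: "(G1 has_real_derivative G2 x) (at x)" if "a \<le> x" "x \<le> b" for x
    unfolding G1_def G2_def using that
    by (auto intro!: derivative_eq_intros d0 d1 d2 simp: algebra_simps power2_eq_square)
  have D2: "(G2 has_real_derivative - ((x - a)^2 * f4 x)) (at x)" if "a \<le> x" "x \<le> b" for x
    unfolding G2_def using that
    by (auto intro!: derivative_eq_intros d1 d2 d3 simp: algebra_simps power2_eq_square)
  have at_a: "G a = 0" "G1 a = 0" "G2 a = 0"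
    by (simp_all add: G_def G1_def G2_def)
  \<comment> \<open>The sign \<open>s\<close> treats both halves of the absolute value at once:
    \<open>s = 1\<close> bounds \<open>G b\<close> from below, \<open>s = - 1\<close> from
    above.\<close>
  have pos: "0 \<le> M * (b - a)^5 / 60 + s * G b" if s: "\<bar>s\<bar> = 1" for s
  proof -
    have N3: "0 \<le> M * (x - a)^2 - s * ((x - a)^2 * f4 x)" if x: "a \<le> x" "x \<le> b" for x
    proof -
      have "s * f4 x \<le> \<bar>s * f4 x\<bar>" by (rule abs_ge_self)
      also have "\<dots> \<le> M" using s bound[OF x] by (simp add: abs_mult)
      finally have "0 \<le> (x - a)^2 * (M - s * f4 x)" by simp
      then show ?thesis by (simp add: algebra_simps)
    qed
    \<comment> \<open>\<open>M * (x - a)^2\<close> is integrated from \<open>a\<close> three times,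
      which gives the denominators 3, 3 * 4 = 12 and 3 * 4 * 5 = 60. The left side of each
      inequality vanishes at \<open>a\<close> and has that of the previous one as its
      derivative.\<close>
    have N2: "0 \<le> M * (x - a)^3 / 3 + s * G2 x" if x: "a \<le> x" "x \<le> b" for x
      by (rule nonneg_if_deriv_nonneg[OF _ N3 _ x])
        (auto intro!: derivative_eq_intros D2 simp: at_a)
    have N1: "0 \<le> M * (x - a)^4 / 12 + s * G1 x" if x: "a \<le> x" "x \<le> b" for x
      by (rule nonneg_if_deriv_nonneg[OF _ N2 _ x])
        (auto intro!: derivative_eq_intros D1 simp: at_a)
    show ?thesis
      by (rule nonneg_if_deriv_nonneg[OF _ N1, where x = b and b = b])
        (use \<open>a \<le> b\<close> in \<open>auto intro!: derivative_eq_intros D0 simp: at_a\<close>)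
  qed
  have "\<bar>G b\<bar> \<le> M * (b - a)^5 / 60"
    using pos[of 1] pos[of "- 1"] by (simp add: abs_le_iff)
  then show ?thesis by (simp add: G_def)
qed

theorem theorem3p3:
  fixes a b \<alpha> q :: real
  assumes "0 < a" and "0 < b" and "a < b"
    and "0 < \<alpha>" and "\<alpha> \<le> 1"
    and "1 \<le> q"
  shows "\<bar>12 * A (a powr (\<alpha> + 4)) (b powr (\<alpha> + 4)) - 12 * L (\<alpha> + 4) a b
            - (b - a)^2 * (\<alpha> + 3) * (\<alpha> + 4) * L (\<alpha> + 2) a b\<bar>
         \<le> (b - a)^4 / 60 * (\<alpha> + 1) * (\<alpha> + 2) * (\<alpha> + 3) * (\<alpha> + 4)
            * (max (\<bar>a powr \<alpha>\<bar> powr q) (\<bar>b powr \<alpha>\<bar> powr q)) powr (1 / q)"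
proof -
  define h where "h = b - a"
  define C where "C = (\<alpha> + 1) * (\<alpha> + 2) * (\<alpha> + 3) * (\<alpha> + 4)"
  \<comment> \<open>The fourth derivative of \<open>x powr (\<alpha> + 4)\<close> is
    \<open>C * x powr \<alpha>\<close>. As \<alpha> > 0, it is largest at the right endpoint
    \<open>b\<close>.\<close>
  define M where "M = C * b powr \<alpha>"
  have h: "h > 0" using assms by (simp add: h_def)
  have C: "C \<ge> 0" using assms by (simp add: C_def)
  \<comment> \<open>The exponent \<open>s\<close> is kept apart from \<open>r - 1\<close> so that
    the derivatives come out with exponents such as \<open>\<alpha> + 3\<close> instead of
    \<open>\<alpha> + 4 - 1\<close>.\<close>
  have D: "((\<lambda>x. c * x powr r) has_real_derivative c * (r * x powr s)) (at x)"
    if "a \<le> x" "s = r - 1" for c r s x :: real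
    using that assms by (auto intro!: derivative_eq_intros)
  \<comment> \<open>\<open>E\<close> is \<open>h\<close> times the expression to be bounded, in the
    shape of the trapezoid lemma with
    \<open>F x = x powr (\<alpha> + 5) / (\<alpha> + 5)\<close>.\<close>
  define E where "E = 6 * h * (a powr (\<alpha> + 4) + b powr (\<alpha> + 4))
      - 12 * (b powr (\<alpha> + 5) / (\<alpha> + 5) - a powr (\<alpha> + 5) / (\<alpha> + 5))
      - h^2 * ((\<alpha> + 4) * b powr (\<alpha> + 3) - (\<alpha> + 4) * a powr (\<alpha> + 3))"
  have "\<bar>E\<bar> \<le> M * h^5 / 60"
    unfolding E_def h_def
  proof (rule corrected_trapezoid_error)
    fix x assume x: "a \<le> x" "x \<le> b"
    show "((\<lambda>x. x powr (\<alpha> + 5) / (\<alpha> + 5)) has_real_derivative x powr (\<alpha> + 4)) (at x)"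
      using D[OF x(1), of "\<alpha> + 4" "\<alpha> + 5" "1 / (\<alpha> + 5)"] assms by simp
    show "((\<lambda>x. x powr (\<alpha> + 4)) has_real_derivative (\<alpha> + 4) * x powr (\<alpha> + 3)) (at x)"
      using D[OF x(1), of "\<alpha> + 3" "\<alpha> + 4" 1] by simp
    show "((\<lambda>x. (\<alpha> + 4) * x powr (\<alpha> + 3)) has_real_derivative
        (\<alpha> + 4) * (\<alpha> + 3) * x powr (\<alpha> + 2)) (at x)"
      using D[OF x(1), of "\<alpha> + 2" "\<alpha> + 3" "\<alpha> + 4"] by (simp add: mult.assoc)
    show "((\<lambda>x. (\<alpha> + 4) * (\<alpha> + 3) * x powr (\<alpha> + 2)) has_real_derivative
        (\<alpha> + 4) * (\<alpha> + 3) * (\<alpha> + 2) * x powr (\<alpha> + 1)) (at x)"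
      using D[OF x(1), of "\<alpha> + 1" "\<alpha> + 2" "(\<alpha> + 4) * (\<alpha> + 3)"] by (simp add: mult.assoc)
    show "((\<lambda>x. (\<alpha> + 4) * (\<alpha> + 3) * (\<alpha> + 2) * x powr (\<alpha> + 1)) has_real_derivative
        C * x powr \<alpha>) (at x)"
      using D[OF x(1), of "\<alpha>" "\<alpha> + 1" "(\<alpha> + 4) * (\<alpha> + 3) * (\<alpha> + 2)"]
      by (simp add: C_def mult_ac)
    show "\<bar>C * x powr \<alpha>\<bar> \<le> M"
      using C x assms by (auto simp: M_def abs_mult intro!: mult_left_mono powr_mono2)
  qed (use assms in simp)
  then have "\<bar>E / h\<bar> \<le> M * h^5 / 60 / h"
    using h divide_right_mono[of "\<bar>E\<bar>" "M * h^5 / 60" h] by simp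
  also have "M * h^5 / 60 / h = h^4 / 60 * C * b powr \<alpha>"
    using h by (simp add: M_def eval_nat_numeral)
  also have "E / h = 12 * A (a powr (\<alpha> + 4)) (b powr (\<alpha> + 4)) - 12 * L (\<alpha> + 4) a b
            - h^2 * (\<alpha> + 3) * (\<alpha> + 4) * L (\<alpha> + 2) a b"
  proof -
    have LE: "L (\<alpha> + 4) a b = (b powr (\<alpha> + 5) / (\<alpha> + 5) - a powr (\<alpha> + 5) / (\<alpha> + 5)) / h"
      by (simp add: L_def h_def diff_divide_distrib add.assoc)
    \<comment> \<open>The factor \<open>\<alpha> + 3\<close> cancels the denominator of
      \<open>L\<close>. Multiplied by \<open>\<alpha> + 4\<close>, this is the difference quotient
      of the first derivative of \<open>x powr (\<alpha> + 4)\<close>.\<close>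
    have LE2: "(\<alpha> + 3) * L (\<alpha> + 2) a b = (b powr (\<alpha> + 3) - a powr (\<alpha> + 3)) / h"
      using assms by (simp add: L_def h_def add.assoc)
    have R: "h^2 * (\<alpha> + 3) * (\<alpha> + 4) * L (\<alpha> + 2) a b = h^2 * (\<alpha> + 4) * ((\<alpha> + 3) * L (\<alpha> + 2) a b)"
      by (simp add: mult_ac)
    show ?thesis
      unfolding R LE LE2 A_def E_def using h by (simp add: field_simps)
  qed
  \<comment> \<open>The maximum is attained at \<open>b\<close>, and the exponent
    \<open>1 / q\<close> undoes the power \<open>q\<close>, so the bound is the same for every
    \<open>q\<close>.\<close>
  also have "b powr \<alpha> = max (\<bar>a powr \<alpha>\<bar> powr q) (\<bar>b powr \<alpha>\<bar> powr q) powr (1 / q)"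
  proof -
    have "\<bar>a powr \<alpha>\<bar> powr q \<le> \<bar>b powr \<alpha>\<bar> powr q"
      using assms by (auto intro!: powr_mono2)
    then show ?thesis using assms by (simp add: max_absorb2 powr_powr)
  qed
  finally show ?thesis
    by (simp add: h_def C_def mult.assoc)
qed

end
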